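(* Let $n \ge 2$, let $\mu_1, \mu_2, \dots, \mu_n$ be non-atomic Borel probability measures on $[0,1]$, and let $\alpha_1, \alpha_2, \dots, \alpha_n$ be non-negative real numbers with $\sum_{i=1}^n \alpha_i = 1$. Then there exists a partition $[0,1] = X_1 \cup X_2 \cup \dots \cup X_n$ into pairwise disjoint sets with $\mu_i(X_i) \ge \alpha_i$ for all $1 \le i \le n$, obtained by cutting $[0,1]$ at no more than $3n-4$ points (i.e., the interval is divided by at most $3n-4$ cut points into at most $3n-3$ subintervals, and each $X_i$ is a union of some of these subintervals).
   Context: A partition $X_1 \cup \dots \cup X_n$ of $[0,1]$ with $\mu_i(X_i) \ge \alpha_i$ for all $i$ is called a disproportionate division for the demands $\alpha_1,\dots,\alpha_n$. The number of cuts of such a division is the number of points at which $[0,1]$ is cut so that each piece $X_i$ is a union of the resulting intervals. *)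

theory Defs
  imports "HOL-Probability.Probability"
begin

definition borel_prob_on_unit :: "real measure \<Rightarrow> bool" where
  "borel_prob_on_unit M \<longleftrightarrow>
     prob_space M \<and> sets M = sets (restrict_space borel {0..1::real})"

definition non_atomic :: "real measure \<Rightarrow> bool" where
  "non_atomic M \<longleftrightarrow> (\<forall>x. emeasure M {x} = 0)"

text \<open>The sets X i (i in I) form a partition of [0,1] obtained by cutting [0,1]
  at the (finitely many) points of C: they are pairwise disjoint, cover [0,1],
  and two points of [0,1] that are not separated by a cut point (the closed
  segment between them contains no point of C) lie in the same piece. Hence each
  X i is a union of the open subintervals between consecutive cuts, plus
  possibly some of the cut points themselves.\<close>
definition cut_partition :: "real set \<Rightarrow> nat set \<Rightarrow> (nat \<Rightarrow> real set) \<Rightarrow> bool" where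
  "cut_partition C I X \<longleftrightarrow>
     finite C \<and> C \<subseteq> {0<..<1} \<and>
     (\<forall>i\<in>I. X i \<subseteq> {0..1}) \<and>
     (\<Union>i\<in>I. X i) = {0..1} \<and>
     (\<forall>i\<in>I. \<forall>j\<in>I. i \<noteq> j \<longrightarrow> X i \<inter> X j = {}) \<and>
     (\<forall>x\<in>{0..1}. \<forall>y\<in>{0..1}. {min x y..max x y} \<inter> C = {} \<longrightarrow>
        (\<forall>i\<in>I. x \<in> X i \<longleftrightarrow> y \<in> X i))"

end

theory Submission
  imports Defs
begin

text \<open>
  Induction on the number of agents, for an interval \<open>[a, b]\<close> that every agent values at least at
  the total demand. Move a knife at \<open>x\<close> from \<open>a\<close> to the right and stop when for the first time an
  agent \<open>q\<close> who values \<open>[a, x]\<close> most finds its own demand met there. If \<open>q\<close> is met exactly, it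
  leaves with \<open>[a, x]\<close>. Otherwise \<open>q\<close> is tied with an agent \<open>p\<close> whose demand exceeds the common value
  \<open>f\<close> of \<open>[a, x]\<close>: then \<open>p\<close> and \<open>q\<close> share \<open>[a, x]\<close> with two cuts, \<open>q\<close> receiving its whole demand \<open>\<alpha> q\<close>
  and \<open>p\<close> the part \<open>f - \<alpha> q\<close>, and all agents but \<open>q\<close> share \<open>[x, b]\<close>, where \<open>p\<close> collects the rest.
  Either way one agent is removed at the cost of at most three cuts.

  For two agents, parametrise the interval by the first agent's measure and close it up to a
  circle. The arcs on which the first agent has relative value \<open>\<theta>\<close> have average relative value \<open>\<theta>\<close>
  for the second one, so on some arc the second agent's value is at most \<open>\<theta>\<close>.
\<close>

section \<open>Two agents: averaging over the arcs of a circle\<close>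

text \<open>Supplies the strict half of the contradiction in \<open>monotone_chord\<close>. The
  integrands there may be discontinuous, so strictness comes from the interval having positive
  Lebesgue measure.\<close>

lemma integral_less_lebesgue_on:
  fixes f g :: "real \<Rightarrow> real"
  assumes "a < b" and int: "integrable (lebesgue_on {a..b}) f" "integrable (lebesgue_on {a..b}) g"
    and less: "\<And>x. x \<in> {a..b} \<Longrightarrow> f x < g x"
  shows "integral {a..b} f < integral {a..b} g"
proof -
  have meas: "{a..b} \<in> sets lebesgue" by simp
  have emeasure: "emeasure (lebesgue_on {a..b}) {a..b} = ennreal (b - a)"
    using \<open>a < b\<close> by (subst emeasure_restrict_space) auto
  interpret finite_measure "lebesgue_on {a..b}"
    by (rule finite_measureI) (simp add: emeasure space_restrict_space)
  have "integral\<^sup>L (lebesgue_on {a..b}) f < integral\<^sup>L (lebesgue_on {a..b}) g"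
    using \<open>a < b\<close> less emeasure
    by (intro integral_less_AE_space int) (auto simp: space_restrict_space)
  then show ?thesis
    using lebesgue_integral_eq_integral[OF int(1) meas]
      lebesgue_integral_eq_integral[OF int(2) meas] by simp
qed

text \<open>On the circle, an arc of length \<theta> either stays inside [0,1] or wraps around, and
  then its complement is a chord of length 1 - \<theta>. The increments over all chords of length
  \<theta> and those over all chords of length 1 - \<theta> have the same integral; if both
  alternatives failed, it would be above \<theta> * (1 - \<theta>) and also at most that.\<close>

lemma monotone_chord:
  fixes h :: "real \<Rightarrow> real" and \<theta> :: real
  assumes h: "mono_on {0..1} h" and \<theta>: "0 < \<theta>" "\<theta> < 1"
  shows "(\<exists>u\<in>{0..1-\<theta>}. h (u + \<theta>) - h u \<le> \<theta>) \<or>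
         (\<exists>u\<in>{0..\<theta>}. 1 - \<theta> \<le> h (u + (1 - \<theta>)) - h u)"
proof (rule ccontr)
  assume "\<not> ?thesis"
  then have less: "\<And>u. u \<in> {0..1-\<theta>} \<Longrightarrow> \<theta> < h (u + \<theta>) - h u"
    and greater: "\<And>u. u \<in> {0..\<theta>} \<Longrightarrow> h (u + (1 - \<theta>)) - h u \<le> 1 - \<theta>"
    by (meson not_le less_imp_le)+
  have int: "h integrable_on {c..d}" if "0 \<le> c" "d \<le> 1" for c d
    using integrable_on_mono_on[OF h] that by (rule_tac integrable_subinterval_real) auto
  have diff: "integral {0..1-t} (\<lambda>u. h (u + t) - h u) = integral {t..1} h - integral {0..1-t} h"
    "(\<lambda>u. h (u + t) - h u) integrable_on {0..1-t}"
    if "0 < t" "t < 1" for t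
  proof -
    have "(\<lambda>u. h (u + t)) integrable_on {0..1-t}"
      using integrable_shift_real_ivl[OF int[of t 1], of t] that by simp
    moreover have "integral {0..1-t} (\<lambda>u. h (u + t)) = integral {t..1} h"
      using integral_shift_real_ivl[of t t 1 h] by simp
    ultimately show "integral {0..1-t} (\<lambda>u. h (u + t) - h u) = integral {t..1} h - integral {0..1-t} h"
      "(\<lambda>u. h (u + t) - h u) integrable_on {0..1-t}"
      using int[of 0 "1-t"] that by (auto simp: integral_diff intro: integrable_diff)
  qed
  have "integral {0..1-\<theta>} (\<lambda>u. \<theta>) < integral {0..1-\<theta>} (\<lambda>u. h (u + \<theta>) - h u)"
  proof (rule integral_less_lebesgue_on)
    have "mono_on {0..1-\<theta>} (\<lambda>u. h (u + \<theta>))" "mono_on {0..1-\<theta>} h"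
      using \<theta> by (auto intro!: mono_onI mono_onD[OF h])
    then show "integrable (lebesgue_on {0..1-\<theta>}) (\<lambda>u. h (u + \<theta>) - h u)"
      by (intro Bochner_Integration.integrable_diff integrable_mono_on)
  qed (use \<theta> less in \<open>auto intro!: integrable_mono_on mono_onI\<close>)
  then have 1: "\<theta> * (1 - \<theta>) < integral {\<theta>..1} h - integral {0..1-\<theta>} h"
    using \<theta> diff(1)[of \<theta>] by (simp add: mult.commute)
  have "integral {0..\<theta>} (\<lambda>u. h (u + (1 - \<theta>)) - h u) \<le> integral {0..\<theta>} (\<lambda>u. 1 - \<theta>)"
    using \<theta> greater diff(2)[of "1 - \<theta>"] by (intro integral_le) auto
  then have 2: "integral {1-\<theta>..1} h - integral {0..\<theta>} h \<le> \<theta> * (1 - \<theta>)"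
    using \<theta> diff(1)[of "1 - \<theta>"] by (simp add: mult.commute)
  \<comment> \<open>Splitting the integral of \<open>h\<close> at \<theta> and at 1 - \<theta> shows
    that the differences bounded in \<open>1\<close> and \<open>2\<close> coincide.\<close>
  have "integral {0..t} h + integral {t..1} h = integral {0..1} h" if "0 < t" "t < 1" for t
    using that by (intro Henstock_Kurzweil_Integration.integral_combine int) auto
  from this[of \<theta>] this[of "1 - \<theta>"] 1 2 \<theta> show False by simp
qed

text \<open>One agent takes the middle and the other both ends, so an arc that wraps around still
  costs only the two cuts \<open>s\<close> and \<open>t\<close>.\<close>

lemma two_agents_interval:
  fixes f g :: "real \<Rightarrow> real"
  assumes "a \<le> b" and cont: "continuous_on {a..b} f"
    and f: "mono_on {a..b} f" and g: "mono_on {a..b} g"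
    and nonneg: "0 \<le> \<alpha>" "0 \<le> \<beta>"
    and total: "\<alpha> + \<beta> \<le> f b - f a" "\<alpha> + \<beta> \<le> g b - g a"
  obtains s t where "a \<le> s" "s \<le> t" "t \<le> b"
    "\<alpha> \<le> f t - f s \<and> \<beta> \<le> (g s - g a) + (g b - g t) \<or>
     \<beta> \<le> g t - g s \<and> \<alpha> \<le> (f s - f a) + (f b - f t)"
proof (cases "\<alpha> = 0 \<or> \<beta> = 0")
  case True
  \<comment> \<open>The middle is empty and the agent with positive demand, if any, takes
    everything. From here on \<theta> lies strictly between 0 and 1.\<close>
  then show ?thesis
    using that[of a a] assms by auto
next
  case False
  define P Q \<theta> where "P = f b - f a" and "Q = g b - g a" and "\<theta> = \<alpha> / (\<alpha> + \<beta>)"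
  have pos: "0 < \<alpha>" "0 < \<beta>" using False nonneg by auto
  then have \<theta>: "0 < \<theta>" "\<theta> < 1" and 1: "1 - \<theta> = \<beta> / (\<alpha> + \<beta>)"
    by (auto simp: \<theta>_def field_simps)
  have PQ: "0 < P" "0 < Q" using pos total by (auto simp: P_def Q_def)
  have \<theta>P: "\<alpha> \<le> \<theta> * P"
    using mult_left_mono[OF total(1), of \<theta>] pos \<theta> by (simp add: \<theta>_def P_def)
  have \<theta>Q: "\<beta> \<le> (1 - \<theta>) * Q" 
    using mult_left_mono[OF total(2), of "1 - \<theta>"] pos \<theta> by (simp add: 1 Q_def)
  have "\<exists>x. a \<le> x \<and> x \<le> b \<and> f x = f a + u * P" if "u \<in> {0..1}" for u
  proof (rule IVT')
    show "f a \<le> f a + u * P" using that PQ by simp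
    have "u * P \<le> 1 * P" using that PQ by (intro mult_right_mono) auto
    then show "f a + u * P \<le> f b" by (simp add: P_def)
  qed (use assms in auto)
  \<comment> \<open>\<open>e\<close> is a right inverse of the normalised \<open>f\<close>. On
    plateaus of \<open>f\<close> its value is an arbitrary choice, yet it is monotone, since
    distinct arguments give distinct values of \<open>f\<close>.\<close>
  then obtain e where e: "\<And>u. u \<in> {0..1} \<Longrightarrow> e u \<in> {a..b} \<and> f (e u) = f a + u * P"
    by (metis atLeastAtMost_iff)
  have e_mono: "e u \<le> e v" if "u \<in> {0..1}" "v \<in> {0..1}" "u \<le> v" for u v
  proof (rule ccontr)
    assume *: "\<not> e u \<le> e v"
    then have "f (e v) \<le> f (e u)" using e[OF that(1)] e[OF that(2)] by (intro mono_onD[OF f]) auto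
    then have "v * P \<le> u * P" using e that by simp
    then have "u = v" using PQ that by simp
    then show False using * by simp
  qed
  define h where "h u = g (e u) / Q" for u
  have "mono_on {0..1} h"
  proof (rule mono_onI)
    fix u v :: real assume "u \<in> {0..1}" "v \<in> {0..1}" "u \<le> v"
    then have "g (e u) \<le> g (e v)" using e e_mono by (intro mono_onD[OF g]) auto
    then show "h u \<le> h v" using PQ by (simp add: h_def divide_right_mono)
  qed
  from monotone_chord[OF this \<theta>] consider
    (1) u where "u \<in> {0..1-\<theta>}" "h (u + \<theta>) - h u \<le> \<theta>" |
    (2) u where "u \<in> {0..\<theta>}" "1 - \<theta> \<le> h (u + (1 - \<theta>)) - h u"
    by blast
  then show ?thesis
  proof cases
    case 1
    then have u: "u \<in> {0..1}" "u + \<theta> \<in> {0..1}" using \<theta> by auto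
    have "g (e (u + \<theta>)) - g (e u) \<le> \<theta> * Q" using 1 PQ by (simp add: h_def field_simps)
    then have "\<beta> \<le> (g (e u) - g a) + (g b - g (e (u + \<theta>)))"
      using \<theta>Q by (simp add: Q_def algebra_simps)
    moreover have "\<alpha> \<le> f (e (u + \<theta>)) - f (e u)"
      using \<theta>P e[OF u(1)] e[OF u(2)] by (simp add: algebra_simps)
    ultimately show ?thesis
      using that[of "e u" "e (u + \<theta>)"] e[OF u(1)] e[OF u(2)] e_mono[OF u] \<theta> by auto
  next
    case 2
    then have u: "u \<in> {0..1}" "u + (1 - \<theta>) \<in> {0..1}" using \<theta> by auto
    have "(1 - \<theta>) * Q \<le> g (e (u + (1 - \<theta>))) - g (e u)" using 2 PQ by (simp add: h_def field_simps)
    then have "\<beta> \<le> g (e (u + (1 - \<theta>))) - g (e u)"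
      using \<theta>Q by simp
    moreover have "f (e (u + (1 - \<theta>))) - f (e u) = (1 - \<theta>) * P"
      using e[OF u(1)] e[OF u(2)] by (simp add: algebra_simps)
    then have "\<alpha> \<le> (f (e u) - f a) + (f b - f (e (u + (1 - \<theta>))))"
      using \<theta>P by (simp add: P_def algebra_simps)
    ultimately show ?thesis
      using that[of "e u" "e (u + (1 - \<theta>))"] e[OF u(1)] e[OF u(2)] e_mono[OF u] \<theta> by auto
  qed
qed

section \<open>The moving knife\<close>

text \<open>Both "some leader is met" and "some leader has at most its demand" define closed sets of
  positions. The first contains its infimum \<open>x\<close>; the second contains everything before
  \<open>x\<close>, hence also \<open>x\<close>. The two leaders found at \<open>x\<close> have
  equal values there.\<close>

lemma first_satisfied_leader:
  fixes F :: "'i \<Rightarrow> real \<Rightarrow> real" and \<alpha> :: "'i \<Rightarrow> real"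
  assumes I: "finite I" "I \<noteq> {}" and "a \<le> b"
    and cont: "\<And>i. i \<in> I \<Longrightarrow> continuous_on {a..b} (F i)"
    and start: "\<And>i. i \<in> I \<Longrightarrow> F i a = 0"
    and finish: "\<And>i. i \<in> I \<Longrightarrow> \<alpha> i \<le> F i b"
    and nonneg: "\<And>i. i \<in> I \<Longrightarrow> 0 \<le> \<alpha> i"
  obtains x p q where "x \<in> {a..b}" "p \<in> I" "q \<in> I" "F p x = F q x"
    "\<And>j. j \<in> I \<Longrightarrow> F j x \<le> F p x" "\<alpha> q \<le> F q x" "F p x \<le> \<alpha> p"
proof -
  have leader: "\<exists>i\<in>I. \<forall>j\<in>I. F j x \<le> F i x" for x
    using Max_in[of "(\<lambda>i. F i x) ` I"] Max_ge[of "(\<lambda>i. F i x) ` I"] I by fastforce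
  have closed_le: "closed {x \<in> {a..b}. u x \<le> v x}"
    if "continuous_on {a..b} u" "continuous_on {a..b} v" for u v :: "real \<Rightarrow> real"
    using continuous_closed_preimage[OF continuous_on_diff[OF that], of "{..0}"]
    by (simp add: vimage_def Int_def)
  have closed_all: "closed {x \<in> {a..b}. \<forall>j\<in>I. F j x \<le> F i x}" if "i \<in> I" for i
  proof -
    have "{x \<in> {a..b}. \<forall>j\<in>I. F j x \<le> F i x} = (\<Inter>j\<in>I. {x \<in> {a..b}. F j x \<le> F i x})"
      using I by auto
    then show ?thesis using closed_le cont that by auto
  qed
  define S where "S i = {x \<in> {a..b}. \<forall>j\<in>I. F j x \<le> F i x} \<inter> {x \<in> {a..b}. \<alpha> i \<le> F i x}" for i
  define U where "U i = {x \<in> {a..b}. \<forall>j\<in>I. F j x \<le> F i x} \<inter> {x \<in> {a..b}. F i x \<le> \<alpha> i}" for i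
  have closed: "closed (\<Union>i\<in>I. S i)" "closed (\<Union>i\<in>I. U i)"
    unfolding S_def U_def using I
    by (auto simp del: Collect_conj_eq mem_Collect_eq atLeastAtMost_iff
      intro!: closed_UN closed_Int closed_all closed_le cont continuous_on_const)
  define x where "x = Inf (\<Union>i\<in>I. S i)"
  have "b \<in> (\<Union>i\<in>I. S i)"
    using leader[of b] finish \<open>a \<le> b\<close> by (auto simp: S_def)
  moreover have bdd: "bdd_below (\<Union>i\<in>I. S i)"
    by (auto simp: S_def intro: bdd_belowI[of _ a])
  ultimately have "x \<in> (\<Union>i\<in>I. S i)"
    unfolding x_def using closed(1) by (intro closed_contains_Inf) auto
  then obtain q where q: "q \<in> I" "x \<in> S q" by auto
  then have x: "x \<in> {a..b}" by (auto simp: S_def)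
  have before: "y \<in> (\<Union>i\<in>I. U i)" if "y \<in> {a..<x}" for y
  proof -
    have "y \<notin> (\<Union>i\<in>I. S i)"
      using that cInf_lower[OF _ bdd, of y] by (auto simp: x_def)
    moreover obtain i where "i \<in> I" "\<forall>j\<in>I. F j y \<le> F i y" using leader by blast
    ultimately have "y \<in> U i" using that x by (auto simp: S_def U_def)
    then show ?thesis using \<open>i \<in> I\<close> by blast
  qed
  have "x \<in> (\<Union>i\<in>I. U i)"
  proof (cases "x = a")
    case True
    \<comment> \<open>No position precedes \<open>x\<close> here, but all values are 0 at
      \<open>a\<close>, so no leader exceeds its demand.\<close>
    then show ?thesis using I start nonneg \<open>a \<le> b\<close> by (auto simp: U_def)
  next
    case False
    then have "closure {a..<x} = {a..x}" using x by (intro closure_atLeastLessThan) auto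
    moreover have "closure {a..<x} \<subseteq> (\<Union>i\<in>I. U i)"
      using before closed(2) by (intro closure_minimal) auto
    ultimately show ?thesis using x by auto
  qed
  then obtain p where "p \<in> I" "x \<in> U p" by auto
  with q x show ?thesis
    by (intro that[of x p q]) (auto simp: S_def U_def intro: antisym)
qed

section \<open>Divisions with a bounded number of cuts\<close>

text \<open>
  A division is encoded by an owner function \<open>w\<close>. It has to be constant between cuts only inside
  the open interval, which makes gluing at an endpoint harmless.
\<close>
definition divisible ::
  "('i \<Rightarrow> real measure) \<Rightarrow> nat \<Rightarrow> 'i set \<Rightarrow> ('i \<Rightarrow> real) \<Rightarrow> real \<Rightarrow> real \<Rightarrow> bool" where
  "divisible M k I \<alpha> a b \<longleftrightarrow>
     (\<exists>C w. finite C \<and> C \<subseteq> {a<..<b} \<and> card C \<le> k \<and>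
        w \<in> borel \<rightarrow>\<^sub>M count_space UNIV \<and> range w \<subseteq> I \<and>
        (\<forall>x y. a < x \<longrightarrow> x \<le> y \<longrightarrow> y < b \<longrightarrow> {x..y} \<inter> C = {} \<longrightarrow> w x = w y) \<and>
        (\<forall>i\<in>I. \<alpha> i \<le> measure (M i) ({a<..<b} \<inter> w -` {i})))"

lemma divisible_mono:
  assumes "divisible M k I \<alpha> a b" and "k \<le> l" "I \<subseteq> J"
    and "\<And>i. i \<in> I \<Longrightarrow> \<beta> i \<le> \<alpha> i" "\<And>i. i \<in> J - I \<Longrightarrow> \<beta> i \<le> 0"
  shows "divisible M l J \<beta> a b"
proof -
  obtain C w where "finite C" "C \<subseteq> {a<..<b}" "card C \<le> k" "w \<in> borel \<rightarrow>\<^sub>M count_space UNIV"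
    "range w \<subseteq> I" "\<forall>x y. a < x \<longrightarrow> x \<le> y \<longrightarrow> y < b \<longrightarrow> {x..y} \<inter> C = {} \<longrightarrow> w x = w y"
    and w: "\<forall>i\<in>I. \<alpha> i \<le> measure (M i) ({a<..<b} \<inter> w -` {i})"
    using assms(1) unfolding divisible_def by blast
  moreover have "\<beta> i \<le> measure (M i) ({a<..<b} \<inter> w -` {i})" if "i \<in> J" for i
    using that w assms(4,5)[of i] by (cases "i \<in> I")
      (auto intro: order_trans[OF _ measure_nonneg] order_trans)
  ultimately show ?thesis
    unfolding divisible_def using assms by (intro exI[of _ C] exI[of _ w]) auto
qed

locale atomless_family =
  fixes M :: "'i \<Rightarrow> real measure"
  assumes finite_borel: "finite_borel_measure (M i)"
    and atomless: "measure (M i) {x} = 0"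
begin

lemma cdf_mono: "x \<le> y \<Longrightarrow> cdf (M i) x \<le> cdf (M i) y"
  by (rule finite_borel_measure.cdf_nondecreasing[OF finite_borel])

lemma cdf_continuous: "continuous_on A (cdf (M i))"
  using finite_borel_measure.isCont_cdf[OF finite_borel] atomless
  by (auto intro: continuous_at_imp_continuous_on)

lemma measure_open_interval:
  assumes "x \<le> y"
  shows "measure (M i) {x<..<y} = cdf (M i) y - cdf (M i) x"
proof (cases "x = y")
  case False
  interpret finite_borel_measure "M i" by (rule finite_borel)
  have "measure (M i) {x<..y} = measure (M i) ({x<..<y} \<union> {y})"
    using assms False by (intro arg_cong[where f="measure (M i)"]) auto
  also have "\<dots> = measure (M i) {x<..<y} + measure (M i) {y}"
    by (rule finite_measure_Union) auto
  finally show ?thesis using cdf_diff_eq[of x y] assms False atomless by simp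
qed simp

lemma divisible_singleton:
  assumes "a \<le> b" "\<alpha> i \<le> cdf (M i) b - cdf (M i) a"
  shows "divisible M 0 {i} \<alpha> a b"
  unfolding divisible_def using assms measure_open_interval[of a b i]
  by (intro exI[of _ "{}"] exI[of _ "\<lambda>_. i"]) auto

text \<open>An agent listed on both sides keeps what it gets on each, so demands add up. This is
  what lets the induction split one agent's demand across the knife.\<close>

lemma divisible_glue:
  assumes "divisible M k I \<alpha> a x" "divisible M l J \<beta> x b" and x: "a \<le> x" "x \<le> b"
  shows "divisible M (k + l + 1) (I \<union> J)
    (\<lambda>i. (if i \<in> I then \<alpha> i else 0) + (if i \<in> J then \<beta> i else 0)) a b"
proof -
  obtain C v where v: "finite C" "C \<subseteq> {a<..<x}" "card C \<le> k" "range v \<subseteq> I"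
    "\<forall>s t. a < s \<longrightarrow> s \<le> t \<longrightarrow> t < x \<longrightarrow> {s..t} \<inter> C = {} \<longrightarrow> v s = v t"
    "\<forall>i\<in>I. \<alpha> i \<le> measure (M i) ({a<..<x} \<inter> v -` {i})"
    and [measurable]: "v \<in> borel \<rightarrow>\<^sub>M count_space UNIV"
    using assms(1) unfolding divisible_def by blast
  obtain D w where w: "finite D" "D \<subseteq> {x<..<b}" "card D \<le> l" "range w \<subseteq> J"
    "\<forall>s t. x < s \<longrightarrow> s \<le> t \<longrightarrow> t < b \<longrightarrow> {s..t} \<inter> D = {} \<longrightarrow> w s = w t"
    "\<forall>i\<in>J. \<beta> i \<le> measure (M i) ({x<..<b} \<inter> w -` {i})"
    and [measurable]: "w \<in> borel \<rightarrow>\<^sub>M count_space UNIV"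
    using assms(2) unfolding divisible_def by blast
  \<comment> \<open>\<open>x\<close> becomes a cut only if it is interior; otherwise one side is an
    empty interval.\<close>
  define E where "E = C \<union> D \<union> ({x} \<inter> {a<..<b})"
  define u where "u y = (if y \<le> x then v y else w y)" for y
  have u[measurable]: "u \<in> borel \<rightarrow>\<^sub>M count_space UNIV"
    unfolding u_def by measurable
  have "card E \<le> card (C \<union> D) + card ({x} \<inter> {a<..<b})"
    unfolding E_def by (rule card_Un_le)
  also have "card (C \<union> D) \<le> card C + card D" by (rule card_Un_le)
  also have "card ({x} \<inter> {a<..<b}) \<le> 1" using card_mono[of "{x}"] by simp
  finally have card: "card E \<le> k + l + 1" using v w by simp
  have const: "u s = u t" if st: "a < s" "s \<le> t" "t < b" "{s..t} \<inter> E = {}" for s t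
  proof -
    have "x \<notin> {s..t}" using st by (auto simp: E_def)
    then consider "t < x" | "x < s" by fastforce
    then show ?thesis
    proof cases
      case 1
      then have "v s = v t" using v(5) st by (auto simp: E_def)
      then show ?thesis using 1 st by (simp add: u_def)
    next
      case 2
      then have "w s = w t" using w(5) st by (auto simp: E_def)
      then show ?thesis using 2 st by (simp add: u_def)
    qed
  qed
  have worth: "(if i \<in> I then \<alpha> i else 0) + (if i \<in> J then \<beta> i else 0)
      \<le> measure (M i) ({a<..<b} \<inter> u -` {i})" for i
  proof -
    interpret finite_borel_measure "M i" by (rule finite_borel)
    have sets: "S \<inter> f -` {i} \<in> sets (M i)"
      if "S \<in> sets borel" "f \<in> borel \<rightarrow>\<^sub>M count_space UNIV" for S and f :: "real \<Rightarrow> 'i"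
      using measurable_sets[OF that(2), of "{i}"] that(1) by (auto simp: M_is_borel)
    have "(if i \<in> I then \<alpha> i else 0) + (if i \<in> J then \<beta> i else 0) \<le>
        measure (M i) ({a<..<x} \<inter> v -` {i}) + measure (M i) ({x<..<b} \<inter> w -` {i})"
      using v(6) w(6) by (intro add_mono) auto
    also have "\<dots> = measure (M i) (({a<..<x} \<inter> v -` {i}) \<union> ({x<..<b} \<inter> w -` {i}))"
      by (rule finite_measure_Union[symmetric]) (auto intro!: sets)
    also have "\<dots> \<le> measure (M i) ({a<..<b} \<inter> u -` {i})"
      using x by (intro finite_measure_mono sets) (auto simp: u_def)
    finally show ?thesis .
  qed
  have "range u \<subseteq> I \<union> J" using v(4) w(4) by (auto simp: u_def)
  moreover have "finite E" "E \<subseteq> {a<..<b}" using v w x by (auto simp: E_def)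
  ultimately show ?thesis
    unfolding divisible_def using card const worth u by (intro exI[of _ E] exI[of _ u]) auto
qed

lemma divisible_two:
  assumes "i \<noteq> j" "a \<le> b" "0 \<le> \<alpha> i" "0 \<le> \<alpha> j"
    and "\<And>l. l \<in> {i, j} \<Longrightarrow> \<alpha> i + \<alpha> j \<le> cdf (M l) b - cdf (M l) a"
  shows "divisible M 2 {i, j} \<alpha> a b"
proof -
  have sandwich: "divisible M 2 {k, l} \<alpha> a b"
    if "k \<noteq> l" "a \<le> s" "s \<le> t" "t \<le> b" "\<alpha> k \<le> cdf (M k) t - cdf (M k) s"
      "\<alpha> l \<le> (cdf (M l) s - cdf (M l) a) + (cdf (M l) b - cdf (M l) t)" for k l s t
  proof -
    have "divisible M 0 {l} (\<lambda>_. cdf (M l) s - cdf (M l) a) a s"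
      "divisible M 0 {k} \<alpha> s t" "divisible M 0 {l} (\<lambda>_. cdf (M l) b - cdf (M l) t) t b"
      using that by (auto intro!: divisible_singleton)
    \<comment> \<open>Three pieces without inner cuts, glued twice, give the count 0 + (0 + 0 + 1) +
      1 = 2.\<close>
    from divisible_glue[OF this(1) divisible_glue[OF this(2,3)]]
    show ?thesis using that by (rule_tac divisible_mono) auto
  qed
  obtain s t where "a \<le> s" "s \<le> t" "t \<le> b"
    "\<alpha> i \<le> cdf (M i) t - cdf (M i) s \<and>
       \<alpha> j \<le> (cdf (M j) s - cdf (M j) a) + (cdf (M j) b - cdf (M j) t) \<or>
     \<alpha> j \<le> cdf (M j) t - cdf (M j) s \<and>
       \<alpha> i \<le> (cdf (M i) s - cdf (M i) a) + (cdf (M i) b - cdf (M i) t)"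
    by (rule two_agents_interval[of a b "cdf (M i)" "cdf (M j)" "\<alpha> i" "\<alpha> j"])
      (use assms in \<open>auto intro!: mono_onI cdf_mono cdf_continuous\<close>)
  then show ?thesis
    using sandwich[of i j s t] sandwich[of j i s t] \<open>i \<noteq> j\<close> by (auto simp: insert_commute)
qed

section \<open>Induction on the number of agents\<close>

text \<open>Two agents need two cuts, and each further agent at most three: two inside [a, x] and
  one at \<open>x\<close>. Only the left endpoint varies in the induction, because the knife always
  removes an initial piece.\<close>

lemma divisible_agents:
  assumes "card I = m + 2" "a \<le> b"
    and "\<And>i. i \<in> I \<Longrightarrow> 0 \<le> \<alpha> i"
    and "\<And>i. i \<in> I \<Longrightarrow> sum \<alpha> I \<le> cdf (M i) b - cdf (M i) a"
  shows "divisible M (3 * m + 2) I \<alpha> a b"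
  using assms
proof (induction m arbitrary: I \<alpha> a)
  case 0
  then obtain i j where "I = {i, j}" "i \<noteq> j" by (auto simp: card_2_iff numeral_2_eq_2[symmetric])
  then show ?case using 0 divisible_two[of i j a b \<alpha>] by (auto simp: numeral_2_eq_2)
next
  case (Suc m)
  have fin: "finite I" using Suc.prems(1) by (auto intro: card_ge_0_finite)
  define F where "F i x = cdf (M i) x - cdf (M i) a" for i x
  have sum_ge: "\<alpha> i \<le> sum \<alpha> I" if "i \<in> I" for i
    using fin that Suc.prems(3) by (intro member_le_sum) auto
  obtain x p q where x: "x \<in> {a..b}" and pq: "p \<in> I" "q \<in> I" "F p x = F q x"
    and lead: "\<And>j. j \<in> I \<Longrightarrow> F j x \<le> F p x" and sat: "\<alpha> q \<le> F q x" "F p x \<le> \<alpha> p"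
  proof (rule first_satisfied_leader[of I a b F \<alpha>])
    show "I \<noteq> {}" using Suc.prems(1) by auto
    show "\<alpha> i \<le> F i b" if "i \<in> I" for i
      using sum_ge[OF that] Suc.prems(4)[OF that] by (simp add: F_def)
  qed (use fin Suc.prems in \<open>auto simp: F_def intro!: continuous_intros cdf_continuous\<close>)
  show ?case
  proof (cases "\<alpha> q = F q x \<or> F p x = \<alpha> p")
    case True
    \<comment> \<open>Either tied leader may be the one met exactly. Nobody values [a, x] above
      \<alpha> r, so the remaining agents still value the rest at their total demand.\<close>
    then obtain r where r: "r \<in> I" "F r x = \<alpha> r" "F p x = \<alpha> r" using pq by metis
    have "divisible M 0 {r} \<alpha> a x"
      using x r by (intro divisible_singleton) (auto simp: F_def)
    moreover have "divisible M (3 * m + 2) (I - {r}) \<alpha> x b"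
    proof (rule Suc.IH)
      show "card (I - {r}) = m + 2" using r Suc.prems(1) by simp
      show "sum \<alpha> (I - {r}) \<le> cdf (M i) b - cdf (M i) x" if "i \<in> I - {r}" for i
        using that lead[of i] Suc.prems(4)[of i] r fin by (simp add: F_def sum_diff1)
    qed (use x Suc.prems in auto)
    ultimately have "divisible M (0 + (3 * m + 2) + 1) ({r} \<union> (I - {r}))
        (\<lambda>i. (if i \<in> {r} then \<alpha> i else 0) + (if i \<in> I - {r} then \<alpha> i else 0)) a b"
      using x by (intro divisible_glue) auto
    then show ?thesis
      by (rule divisible_mono) (use r in auto)
  next
    case False
    define f where "f = F p x"
    have f: "F p x = f" "F q x = f" "\<alpha> q < f" "f < \<alpha> p"
      using False pq sat by (auto simp: f_def)
    then have "p \<noteq> q" by auto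
    \<comment> \<open>The demand of \<open>p\<close> is split into \<beta> p + \<gamma> p, both
      non-negative as \<alpha> q < f < \<alpha> p. The total \<beta> p + \<beta> q is
      \<open>f\<close>, exactly what \<open>p\<close> and \<open>q\<close> each see in
      [a, x].\<close>
    define \<beta> where "\<beta> = \<alpha>(p := f - \<alpha> q)"
    define \<gamma> where "\<gamma> = \<alpha>(p := \<alpha> p + \<alpha> q - f)"
    have "divisible M 2 {p, q} \<beta> a x"
      using \<open>p \<noteq> q\<close> x f Suc.prems(3) pq
      by (intro divisible_two) (auto simp: \<beta>_def F_def)
    moreover have "divisible M (3 * m + 2) (I - {q}) \<gamma> x b"
    proof (rule Suc.IH)
      show "card (I - {q}) = m + 2" using pq Suc.prems(1) by simp
      show "0 \<le> \<gamma> i" if "i \<in> I - {q}" for i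
        using that Suc.prems(3)[of i] Suc.prems(3)[of q] pq f by (auto simp: \<gamma>_def)
      have "sum \<gamma> (I - {q}) = \<gamma> p + sum \<gamma> (I - {q} - {p})"
        using fin pq \<open>p \<noteq> q\<close> by (intro sum.remove) auto
      also have "sum \<gamma> (I - {q} - {p}) = sum \<alpha> (I - {q} - {p})"
        by (intro sum.cong) (auto simp: \<gamma>_def)
      also have "\<dots> = sum \<alpha> I - \<alpha> q - \<alpha> p"
        using fin pq \<open>p \<noteq> q\<close> by (simp add: sum_diff1)
      \<comment> \<open>The total demand drops by \<open>f\<close>, and no remaining agent loses
        more than \<open>f\<close> with [a, x].\<close>
      finally have "sum \<gamma> (I - {q}) = sum \<alpha> I - f" by (simp add: \<gamma>_def)
      then show "sum \<gamma> (I - {q}) \<le> cdf (M i) b - cdf (M i) x" if "i \<in> I - {q}" for i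
        using that lead[of i] Suc.prems(4)[of i] f by (simp add: F_def)
    qed (use x in auto)
    ultimately have "divisible M (2 + (3 * m + 2) + 1) ({p, q} \<union> (I - {q}))
        (\<lambda>i. (if i \<in> {p, q} then \<beta> i else 0) + (if i \<in> I - {q} then \<gamma> i else 0)) a b"
      using x by (intro divisible_glue) auto
    then show ?thesis
      by (rule divisible_mono) (use pq \<open>p \<noteq> q\<close> in \<open>auto simp: \<beta>_def \<gamma>_def\<close>)
  qed
qed

end

section \<open>From owner functions back to partitions of [0,1]\<close>

text \<open>Owners at 0 and 1 are unconstrained, whereas \<open>cut_partition\<close> includes the
  endpoints. Composing \<open>w\<close> with a map \<open>r\<close> into the open interval that
  carries no point onto or across a cut repairs this.\<close>

lemma cut_partition_of_owner:
  fixes w :: "real \<Rightarrow> nat"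
  assumes C: "finite C" "C \<subseteq> {0<..<1}" and w: "w \<in> borel \<rightarrow>\<^sub>M count_space UNIV" "range w \<subseteq> I"
    and const: "\<And>x y. 0 < x \<Longrightarrow> x \<le> y \<Longrightarrow> y < 1 \<Longrightarrow> {x..y} \<inter> C = {} \<Longrightarrow> w x = w y"
  obtains X where "cut_partition C I X" "\<And>i. X i \<in> sets (restrict_space borel {0..1})"
    "\<And>i. {0<..<1} \<inter> w -` {i} \<subseteq> X i"
proof -
  \<comment> \<open>\<open>c\<close> and \<open>d\<close> are the first and last cuts. Without cuts
    they are 1 and 0, and \<open>r\<close> sends both endpoints to 1/2.\<close>
  define c where "c = Min (insert 1 C)"
  define d where "d = Max (insert 0 C)"
  have c: "0 < c" "c \<le> 1" "\<And>x. x \<in> C \<Longrightarrow> c \<le> x"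
    using C by (auto simp: c_def)
  have d: "0 \<le> d" "d < 1" "\<And>x. x \<in> C \<Longrightarrow> x \<le> d"
    using C by (auto simp: d_def)
  \<comment> \<open>The endpoints 0 and 1 inherit the owners of the first and the last open subinterval.\<close>
  define r where "r x = (if x \<le> 0 then c / 2 else if 1 \<le> x then (d + 1) / 2 else x)" for x :: real
  have r: "0 < r x" "r x < 1" for x using c d by (auto simp: r_def)
  have r_cut: "z < r x" if "z \<in> C" "z < x" for x z
    using that c(1) d(2,3) C(2) by (fastforce simp: r_def)
  have r_cut': "r x < z" if "z \<in> C" "x < z" for x z
    using that c(1) c(3)[of z] C(2) by (auto simp: r_def)
  have r_const: "w (r x) = w (r y)" if "0 \<le> x" "x \<le> y" "y \<le> 1" "{x..y} \<inter> C = {}" for x y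
  proof -
    have "{min (r x) (r y)..max (r x) (r y)} \<inter> C = {}"
    proof (rule ccontr)
      assume "\<not> ?thesis"
      then obtain z where z: "z \<in> C" "min (r x) (r y) \<le> z" "z \<le> max (r x) (r y)" by auto
      have "z \<notin> {x..y}" using z(1) that(4) by blast
      \<comment> \<open>A cut outside [x, y] stays on the same side of both \<open>r x\<close> and
        \<open>r y\<close>, so it cannot lie between them.\<close>
      then consider "z < x" | "y < z" by fastforce
      then show False
      proof cases
        case 1
        then have "z < r x" "z < r y" using r_cut[OF z(1)] that(2) by auto
        then show False using z(2) by simp
      next
        case 2
        then have "r x < z" "r y < z" using r_cut'[OF z(1)] that(2) by auto
        then show False using z(3) by simp
      qed
    qed
    then have "w (min (r x) (r y)) = w (max (r x) (r y))"
      using r by (intro const) (auto simp: min_def max_def)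
    then show ?thesis by (auto simp: min_def max_def split: if_splits)
  qed
  define X where "X i = {x \<in> {0..1}. w (r x) = i}" for i
  have "cut_partition C I X"
    unfolding cut_partition_def
  proof (intro conjI)
    show "\<forall>x\<in>{0..1}. \<forall>y\<in>{0..1}. {min x y..max x y} \<inter> C = {} \<longrightarrow> (\<forall>i\<in>I. (x \<in> X i) = (y \<in> X i))"
    proof (intro ballI impI)
      fix x y :: real and i assume xy: "x \<in> {0..1}" "y \<in> {0..1}" "{min x y..max x y} \<inter> C = {}"
      then have "w (r x) = w (r y)"
        using r_const[of "min x y" "max x y"] by (auto simp: min_def max_def split: if_splits)
      then show "(x \<in> X i) = (y \<in> X i)" using xy by (simp add: X_def)
    qed
  qed (use C w in \<open>auto simp: X_def range_subsetD\<close>)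
  moreover have "X i \<in> sets (restrict_space borel {0..1})" for i
  proof -
    have "(\<lambda>x. w (r x)) \<in> borel \<rightarrow>\<^sub>M count_space UNIV"
      using w(1) unfolding r_def by measurable
    from measurable_sets[OF this, of "{i}"] show ?thesis
      by (subst sets_restrict_space_iff) (auto simp: X_def Collect_conj_eq vimage_def)
  qed
  moreover have "{0<..<1} \<inter> w -` {i} \<subseteq> X i" for i by (auto simp: X_def r_def)
  ultimately show ?thesis by (rule that)
qed

section \<open>Transfer to probability measures on [0,1]\<close>

theorem theorem1:
  fixes n :: nat and \<mu> :: "nat \<Rightarrow> real measure" and \<alpha> :: "nat \<Rightarrow> real"
  assumes "n \<ge> 2"
    and "\<And>i. i \<in> {1..n} \<Longrightarrow> borel_prob_on_unit (\<mu> i)"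
    and "\<And>i. i \<in> {1..n} \<Longrightarrow> non_atomic (\<mu> i)"
    and "\<And>i. i \<in> {1..n} \<Longrightarrow> \<alpha> i \<ge> 0"
    and "(\<Sum>i=1..n. \<alpha> i) = 1"
  shows "\<exists>C X. cut_partition C {1..n} X \<and> card C \<le> 3 * n - 4 \<and>
           (\<forall>i\<in>{1..n}. X i \<in> sets (\<mu> i) \<and> measure (\<mu> i) (X i) \<ge> \<alpha> i)"
proof -
  \<comment> \<open>Indices outside \<open>{1..n}\<close> are redirected to 1 because \<open>\<mu>\<close> is arbitrary there.\<close>
  define N where "N i = \<mu> (if i \<in> {1..n} then i else 1)" for i
  \<comment> \<open>Pushing forward along the inclusion of [0,1] into the line makes distribution
    functions available.\<close>
  define M where "M i = distr (N i) borel (\<lambda>x. x)" for i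
  have N: "prob_space (N i)" "sets (N i) = sets (restrict_space borel {0..1})"
    "emeasure (N i) {x} = 0" for i x
    using assms(1) assms(2,3)[of "if i \<in> {1..n} then i else 1"]
    by (auto simp: N_def borel_prob_on_unit_def non_atomic_def)
  have space_N: "space (N i) = {0..1}" for i
    using sets_eq_imp_space_eq[OF N(2)] by (simp add: space_restrict_space)
  have id: "(\<lambda>x. x) \<in> N i \<rightarrow>\<^sub>M borel" for i
    by (subst measurable_cong_sets[OF N(2) refl]) (auto intro: measurable_restrict_space1)
  have M: "measure (M i) A = measure (N i) (A \<inter> {0..1})" if "A \<in> sets borel" for i A
    using measure_distr[OF id that] by (simp add: M_def space_N)
  interpret atomless_family M
  proof (rule atomless_family.intro)
    fix i :: nat and x :: real
    interpret N: prob_space "N i" by (rule N)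
    interpret M: prob_space "M i" unfolding M_def by (rule N.prob_space_distr[OF id])
    show "finite_borel_measure (M i)"
      by unfold_locales (simp add: M_def)
    have "measure (N i) ({x} \<inter> {0..1}) = 0"
      using N(3)[of i x] by (cases "x \<in> {0..1}") (auto simp: measure_def)
    then show "measure (M i) {x} = 0" by (simp add: M)
  qed
  have total: "cdf (M i) 1 - cdf (M i) 0 = 1" for i
  proof -
    interpret N: prob_space "N i" by (rule N)
    have "measure (N i) ({..1} \<inter> {0..1}) = 1"
      using N.prob_space by (simp add: space_N Int_absorb1)
    moreover have "{..0} \<inter> {0..1::real} = {0}" by auto
    then have "measure (N i) ({..0} \<inter> {0..1}) = 0"
      using N(3)[of i 0] by (simp add: measure_def)
    ultimately show ?thesis by (simp add: cdf_def M)
  qed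
  have "divisible M (3 * (n - 2) + 2) {1..n} \<alpha> 0 1"
    using assms(1,4,5) total by (intro divisible_agents) auto
  moreover have "3 * (n - 2) + 2 = 3 * n - 4" using assms(1) by simp
  ultimately obtain C w where C: "finite C" "C \<subseteq> {0<..<1}" "card C \<le> 3 * n - 4"
    and w: "w \<in> borel \<rightarrow>\<^sub>M count_space UNIV" "range w \<subseteq> {1..n}"
    "\<And>x y. 0 < x \<Longrightarrow> x \<le> y \<Longrightarrow> y < 1 \<Longrightarrow> {x..y} \<inter> C = {} \<Longrightarrow> w x = w y"
    and demand: "\<And>i. i \<in> {1..n} \<Longrightarrow> \<alpha> i \<le> measure (M i) ({0<..<1} \<inter> w -` {i})"
    unfolding divisible_def by auto
  obtain X where X: "cut_partition C {1..n} X" "\<And>i. X i \<in> sets (restrict_space borel {0..1})"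
    "\<And>i. {0<..<1} \<inter> w -` {i} \<subseteq> X i"
    using cut_partition_of_owner[OF C(1,2) w] by blast
  have "\<alpha> i \<le> measure (\<mu> i) (X i)" if "i \<in> {1..n}" for i
  proof -
    interpret N: prob_space "N i" by (rule N)
    have "{0<..<1} \<inter> w -` {i} \<in> sets borel"
      using measurable_sets[OF w(1), of "{i}"] by auto
    then have "\<alpha> i \<le> measure (N i) (({0<..<1} \<inter> w -` {i}) \<inter> {0..1})"
      using demand[OF that] by (simp add: M)
    also have "\<dots> \<le> measure (N i) (X i)"
      using X(2,3) N(2) by (intro N.finite_measure_mono) auto
    finally show ?thesis using that by (simp add: N_def)
  qed
  moreover have "X i \<in> sets (\<mu> i)" if "i \<in> {1..n}" for i
    using X(2) assms(2)[OF that] by (simp add: borel_prob_on_unit_def)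
  ultimately show ?thesis using X(1) C(3) by blast
qed

end
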